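(* Let $k\ge 2$ be an integer. The equation $$2(1-r)-r^k(3-r)=0$$ has a unique solution in $(0,1)$; denote it by $S_k$. For every $f\in\mathcal{B}_k$ with expansion $f(z)=\sum_{n=k}^{\infty}a_nz^n$, the inequality $$\sum_{n=k}^{\infty}|a_n|r^n+\left(\frac{r^{-k}}{1+|a_k|}+\frac{r^{1-k}}{1-r}\right)\sum_{n=k}^{\infty}|a_n|^2r^{2n}\le 1$$ holds for all $r\in[0,S_k]$. The upper bound $S_k$ cannot be improved, i.e. $S_k$ cannot be replaced by any larger number $S<1$: for every $S\in(S_k,1)$ there exist $f\in\mathcal{B}_k$ and $r\in[0,S]$ for which the inequality fails.
   Context: $\mathbb{D}=\{z\in\mathbb{C}:|z|<1\}$ is the open unit disk. $\mathcal{B}$ denotes the class of all analytic functions $f$ on $\mathbb{D}$ with $|f(z)|\le 1$ for all $z\in\mathbb{D}$. For $k\in\mathbb{N}$ (positive integers), $\mathcal{B}_k=\{f\in\mathcal{B}: f(0)=\cdots=f^{(k-1)}(0)=0\}$, so each $f\in\mathcal{B}_k$ has a power series $f(z)=\sum_{n=k}^\infty a_nz^n$ on $\mathbb{D}$. Convention: products such as $r^{-k}r^{2n}$ and $r^{1-k}r^{2n}$ are read as $r^{2n-k}$ and $r^{2n+1-k}$, so the left-hand side of the inequality equals $0$ at $r=0$. *)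

theory Defs
  imports "HOL-Complex_Analysis.Complex_Analysis"
begin

definition class_B :: "(complex \<Rightarrow> complex) set" where
  "class_B = {f. f analytic_on ball 0 1 \<and> (\<forall>z\<in>ball 0 1. norm (f z) \<le> 1)}"

definition class_Bk :: "nat \<Rightarrow> (complex \<Rightarrow> complex) set" where
  "class_Bk k = {f \<in> class_B. \<forall>j<k. (deriv ^^ j) f 0 = 0}"

text \<open>Series over \<open>n \<ge> k\<close> are written with the index shifted to \<open>n + k\<close>; the values
  \<open>a 0, \<dots>, a (k - 1)\<close> play no role.\<close>

definition has_expansion :: "nat \<Rightarrow> (nat \<Rightarrow> complex) \<Rightarrow> (complex \<Rightarrow> complex) \<Rightarrow> bool" where
  "has_expansion k a f \<longleftrightarrow> (\<forall>z\<in>ball 0 1. (\<lambda>n. a (n + k) * z ^ (n + k)) sums f z)"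

text \<open>Both series below converge for \<open>0 \<le> r < 1\<close> whenever \<open>a\<close> is the coefficient sequence of a
  power series converging on the unit disk, so \<open>suminf\<close> is their actual sum there.
  At \<open>r = 0\<close> with \<open>k \<ge> 2\<close> the negative powers are \<open>0\<close> by the library convention
  \<open>inverse 0 = 0\<close>; this gives the same value \<open>0\<close> as reading \<open>r powi (- k) * r ^ (2 * n)\<close> as
  \<open>r ^ (2 * n - k)\<close> and \<open>r powi (1 - k) * r ^ (2 * n)\<close> as \<open>r ^ (2 * n + 1 - k)\<close>.\<close>

definition bohr_lhs :: "nat \<Rightarrow> (nat \<Rightarrow> complex) \<Rightarrow> real \<Rightarrow> real" where
  "bohr_lhs k a r =
     (\<Sum>n. norm (a (n + k)) * r ^ (n + k))
     + (r powi (- int k) / (1 + norm (a k)) + r powi (1 - int k) / (1 - r))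
       * (\<Sum>n. (norm (a (n + k)))\<^sup>2 * r ^ (2 * (n + k)))"

lemma bohr_lhs_0:
  assumes "k \<ge> 2"
  shows "bohr_lhs k a 0 = 0"
  using assms by (simp add: bohr_lhs_def power_0_left)

lemma bohr_lhs_powers:
  fixes r :: real
  assumes "r \<noteq> 0" "k \<le> n"
  shows "r powi (- int k) * r ^ (2 * n) = r ^ (2 * n - k)"
    and "r powi (1 - int k) * r ^ (2 * n) = r ^ (2 * n + 1 - k)"
  using assms by (simp_all add: power_int_minus power_int_diff power_diff field_simps)

definition is_bohr_root :: "nat \<Rightarrow> real \<Rightarrow> bool" where
  "is_bohr_root k r \<longleftrightarrow> r \<in> {0<..<1} \<and> 2 * (1 - r) - r ^ k * (3 - r) = 0"

definition bohr_S :: "nat \<Rightarrow> real" where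
  "bohr_S k = (THE r. is_bohr_root k r)"

end

theory Submission
  imports Defs
begin

text \<open>Write \<open>f z = z ^ k * g z\<close> with \<open>g z = (\<Sum>n. b n * z ^ n)\<close>. Multiplication by \<open>g\<close> is a contraction
  in the \<open>L\<^sup>2\<close>-norm on the circle; testing it on suitable polynomials yields Carlson's
  inequalities, which bound \<open>norm (b (2 * n + 1))\<close> and \<open>norm (b (2 * n))\<close> by \<open>1\<close> minus a sum of squares
  of the earlier coefficients. Multiplied by powers of \<open>r\<close> and summed, these squares are exactly
  what the second series of the Bohr sum contributes, so that the Bohr sum is at most
  \<open>r ^ k * (a + a\<^sup>2 / (1 + a) + r / (1 - r))\<close> with \<open>a = norm (b 0) \<le> 1\<close>. For \<open>a = 1\<close> this is at most \<open>1\<close>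
  precisely when \<open>r \<le> bohr_S k\<close>, and \<open>f z = z ^ k\<close> attains it.\<close>

section \<open>Taylor coefficients and Bessel's inequality on circles about 0\<close>

text \<open>This is Cauchy's formula for the \<open>i\<close>-th derivative: along the circle the
  path derivative is \<open>2 * pi * \<i>\<close> times the point itself, which cancels the constant
  and one power in the denominator.\<close>

lemma has_integral_coeff_circle:
  assumes hol: "F holomorphic_on ball 0 1" and exp: "F has_fps_expansion A" and r: "0 < r" "r < 1"
  shows "((\<lambda>t. F (circlepath 0 r t) / circlepath 0 r t ^ i) has_integral fps_nth A i) {0..1}"
proof -
  have "((\<lambda>u. F u / (u - 0) ^ Suc i) has_contour_integral (2 * pi * \<i> / fact i * (deriv ^^ i) F 0))
      (circlepath 0 r)"
  proof (rule Cauchy_has_contour_integral_higher_derivative_circlepath)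
    show "continuous_on (cball 0 r) F"
      using r by (intro holomorphic_on_imp_continuous_on holomorphic_on_subset[OF hol]) auto
    show "F holomorphic_on ball 0 r"
      using r by (intro holomorphic_on_subset[OF hol]) auto
    show "0 \<in> ball 0 r" using r by simp
  qed
  moreover have "(deriv ^^ i) F 0 / fact i = fps_nth A i"
    using fps_nth_fps_expansion[OF exp, of i] by simp
  ultimately have "((\<lambda>u. F u / u ^ Suc i) has_contour_integral (2 * pi * \<i> * fps_nth A i)) (circlepath 0 r)"
    by (simp add: field_simps)
  then have "((\<lambda>t. F (circlepath 0 r t) / circlepath 0 r t ^ Suc i *
      (2 * pi * \<i> * r * exp (2 * of_real pi * \<i> * t))) has_integral (2 * pi * \<i> * fps_nth A i)) {0..1}"
    unfolding has_contour_integral_def vector_derivative_circlepath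
    by (subst (asm) has_integral_cong[where g = "(\<lambda>t. F (circlepath 0 r t) / circlepath 0 r t ^ Suc i *
      (2 * pi * \<i> * r * exp (2 * of_real pi * \<i> * t)))"])
       (auto simp: vector_derivative_circlepath01)
  from has_integral_mult_right[OF this, of "1 / (2 * pi * \<i>)"]
  have "((\<lambda>t. 1 / (2 * pi * \<i>) * (F (circlepath 0 r t) / circlepath 0 r t ^ Suc i *
      (2 * pi * \<i> * r * exp (2 * of_real pi * \<i> * t)))) has_integral fps_nth A i) {0..1}"
    by simp
  moreover have "1 / (2 * pi * \<i>) * (F (circlepath 0 r t) / circlepath 0 r t ^ Suc i *
      (2 * pi * \<i> * r * exp (2 * of_real pi * \<i> * t))) = F (circlepath 0 r t) / circlepath 0 r t ^ i" for t
    using r by (simp add: circlepath field_simps)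
  ultimately show ?thesis by simp
qed

lemma norm_circlepath_0: "r \<ge> 0 \<Longrightarrow> norm (circlepath 0 r t) = r"
  by (simp add: circlepath norm_mult)

text \<open>On the circle \<open>cnj w ^ i = r ^ (2 * i) / w ^ i\<close>, so each conjugated
  monomial extracts one Taylor coefficient of \<open>F\<close>. As the second factor is a
  polynomial, no infinite series has to be integrated termwise.\<close>

lemma has_integral_inner_poly_circle:
  assumes hol: "F holomorphic_on ball 0 1" and exp: "F has_fps_expansion A" and r: "0 < r" "r < 1"
  shows "((\<lambda>t. F (circlepath 0 r t) * cnj (\<Sum>i\<le>D. c i * circlepath 0 r t ^ i))
           has_integral (\<Sum>i\<le>D. fps_nth A i * cnj (c i) * of_real (r ^ (2 * i)))) {0..1}"
proof -
  have "((\<lambda>t. \<Sum>i\<le>D. F (circlepath 0 r t) / circlepath 0 r t ^ i * (cnj (c i) * of_real (r ^ (2 * i))))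
      has_integral (\<Sum>i\<le>D. fps_nth A i * (cnj (c i) * of_real (r ^ (2 * i))))) {0..1}"
    by (intro has_integral_sum has_integral_mult_left has_integral_coeff_circle assms) auto
  moreover have "(\<Sum>i\<le>D. F (circlepath 0 r t) / circlepath 0 r t ^ i * (cnj (c i) * of_real (r ^ (2 * i))))
      = F (circlepath 0 r t) * cnj (\<Sum>i\<le>D. c i * circlepath 0 r t ^ i)" for t
  proof -
    let ?w = "circlepath 0 r t"
    have w: "?w \<noteq> 0" using norm_circlepath_0[of r t] r by auto
    have "?w * cnj ?w = of_real (r\<^sup>2)"
      using norm_circlepath_0[of r t] r by (simp add: complex_norm_square [symmetric])
    then have "cnj ?w ^ i * ?w ^ i = of_real (r ^ (2 * i))" for i
      by (metis mult.commute of_real_power power_mult power_mult_distrib)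
    then have "of_real (r ^ (2 * i)) / ?w ^ i = cnj ?w ^ i" for i
      using w by (simp add: divide_eq_eq)
    then show ?thesis
      by (simp add: sum_distrib_left mult.assoc divide_inverse mult_ac) 
  qed
  ultimately show ?thesis by (simp add: mult.assoc)
qed

lemma parseval_poly_circle:
  assumes r: "0 < r" "r < 1"
  shows "((\<lambda>t. (norm (\<Sum>i\<le>D. c i * circlepath 0 r t ^ i))\<^sup>2)
           has_integral (\<Sum>i\<le>D. (norm (c i))\<^sup>2 * r ^ (2 * i))) {0..1}"
proof -
  let ?P = "\<lambda>z. \<Sum>i\<le>D. c i * z ^ i"
  let ?A = "\<Sum>i\<le>D. fps_const (c i) * fps_X ^ i"
  have nth: "fps_nth ?A i = c i" if "i \<le> D" for i
    using that by (simp add: fps_sum_nth if_distrib sum.delta cong: if_cong)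
  have exp: "?P has_fps_expansion ?A"
    by (intro fps_expansion_intros)
  have "((\<lambda>t. ?P (circlepath 0 r t) * cnj (?P (circlepath 0 r t)))
      has_integral (\<Sum>i\<le>D. fps_nth ?A i * cnj (c i) * of_real (r ^ (2 * i)))) {0..1}"
    by (rule has_integral_inner_poly_circle[OF _ exp r]) (intro holomorphic_intros)
  also have "(\<Sum>i\<le>D. fps_nth ?A i * cnj (c i) * of_real (r ^ (2 * i)))
      = (\<Sum>i\<le>D. of_real ((norm (c i))\<^sup>2 * r ^ (2 * i)))"
    by (intro sum.cong refl) (simp add: nth complex_norm_square [symmetric] del: of_real_power)
  finally have "((\<lambda>t. of_real ((norm (?P (circlepath 0 r t)))\<^sup>2))
      has_integral complex_of_real (\<Sum>i\<le>D. (norm (c i))\<^sup>2 * r ^ (2 * i))) {0..1}"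
    by (simp only: complex_norm_square of_real_sum)
  from has_integral_Re[OF this] show ?thesis by simp
qed

text \<open>Integrate \<open>(norm (F - P))\<^sup>2 \<ge> 0\<close>, where \<open>P\<close> is the
  Taylor polynomial of degree \<open>D\<close>: the inner product of \<open>F\<close> with
  \<open>P\<close> and the squared norm of \<open>P\<close> are the same sum
  \<open>?s\<close>.\<close>

lemma bessel_circle:
  assumes hol: "F holomorphic_on ball 0 1" and exp: "F has_fps_expansion A" and r: "0 < r" "r < 1"
  shows "(\<Sum>i\<le>D. (norm (fps_nth A i))\<^sup>2 * r ^ (2 * i))
           \<le> integral {0..1} (\<lambda>t. (norm (F (circlepath 0 r t)))\<^sup>2)"
    and "(\<lambda>t. (norm (F (circlepath 0 r t)))\<^sup>2) integrable_on {0..1}"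
proof -
  let ?w = "circlepath 0 r" and ?P = "\<lambda>z. \<Sum>i\<le>D. fps_nth A i * z ^ i"
  let ?s = "\<Sum>i\<le>D. (norm (fps_nth A i))\<^sup>2 * r ^ (2 * i)"
  have cont: "continuous_on {0..1} (\<lambda>t. F (?w t))"
    by (rule continuous_on_compose2[OF holomorphic_on_imp_continuous_on[OF hol]])
       (use r norm_circlepath_0[of r] in \<open>auto simp: circlepath intro!: continuous_intros\<close>)
  show int: "(\<lambda>t. (norm (F (?w t)))\<^sup>2) integrable_on {0..1}"
    by (intro integrable_continuous_interval continuous_intros cont)
  have "((\<lambda>t. F (?w t) * cnj (?P (?w t)))
      has_integral (\<Sum>i\<le>D. fps_nth A i * cnj (fps_nth A i) * of_real (r ^ (2 * i)))) {0..1}"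
    by (rule has_integral_inner_poly_circle[OF hol exp r])
  from has_integral_Re[OF this]
  have cross: "((\<lambda>t. Re (F (?w t) * cnj (?P (?w t)))) has_integral ?s) {0..1}"
    by (simp add: complex_norm_square [symmetric] del: of_real_power times_complex.sel
          flip: of_real_mult)
  have "((\<lambda>t. (norm (F (?w t)))\<^sup>2 - 2 * Re (F (?w t) * cnj (?P (?w t))) + (norm (?P (?w t)))\<^sup>2)
      has_integral (integral {0..1} (\<lambda>t. (norm (F (?w t)))\<^sup>2) - 2 * ?s + ?s)) {0..1}"
    by (intro has_integral_add has_integral_diff has_integral_mult_right cross
        integrable_integral int parseval_poly_circle r)
  moreover have "(norm u)\<^sup>2 - 2 * Re (u * cnj v) + (norm v)\<^sup>2 = (norm (u - v))\<^sup>2" for u v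
    by (simp only: cmod_power2) (simp add: power2_eq_square algebra_simps)
  ultimately have "((\<lambda>t. (norm (F (?w t) - ?P (?w t)))\<^sup>2)
      has_integral (integral {0..1} (\<lambda>t. (norm (F (?w t)))\<^sup>2) - 2 * ?s + ?s)) {0..1}"
    by (simp only:)
  then have "0 \<le> integral {0..1} (\<lambda>t. (norm (F (?w t)))\<^sup>2) - 2 * ?s + ?s"
    by (rule has_integral_nonneg) (rule zero_le_power2)
  then show "?s \<le> integral {0..1} (\<lambda>t. (norm (F (?w t)))\<^sup>2)" by simp
qed

section \<open>Multiplication by a bounded function as a contraction\<close>

text \<open>The weight \<open>z ^ k\<close> makes it possible to use the bound on \<open>f z = z ^ k * g z\<close> directly,
  without the maximum principle: on the circle of radius \<open>r\<close> it costs a factor \<open>r ^ (2 * k)\<close>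
  that disappears as \<open>r\<close> tends to \<open>1\<close>.\<close>

locale bounded_series =
  fixes k :: nat and b :: "nat \<Rightarrow> complex" and g :: "complex \<Rightarrow> complex"
  assumes sums: "norm z < 1 \<Longrightarrow> (\<lambda>n. b n * z ^ n) sums g z"
    and bounded: "norm z < 1 \<Longrightarrow> norm (z ^ k * g z) \<le> 1"
begin

lemma holomorphic: "g holomorphic_on ball 0 1"
proof (rule power_series_holomorphic)
  fix z :: complex assume "z \<in> ball 0 1"
  then show "(\<lambda>n. b n * (z - 0) ^ n) sums g z" using sums[of z] by simp
qed

lemma has_fps_expansion: "g has_fps_expansion Abs_fps b"
proof (rule has_fps_expansionI)
  have "eventually (\<lambda>u. u \<in> ball (0::complex) 1) (nhds 0)"
    by (intro eventually_nhds_in_open) auto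
  then show "eventually (\<lambda>u. (\<lambda>n. fps_nth (Abs_fps b) n * u ^ n) sums g u) (nhds 0)"
    by eventually_elim (simp add: sums)
qed

text \<open>The inner sums are the coefficients of \<open>P * g\<close> for the polynomial
  \<open>P\<close> with coefficients \<open>h\<close>. On a circle, Bessel bounds their squares by
  the norm of \<open>P * g\<close>, and the bound on \<open>z ^ k * g z\<close> reduces this to the
  norm of \<open>P\<close>.\<close>

lemma toeplitz_contraction:
  assumes h: "\<And>j. j > D \<Longrightarrow> h j = 0"
  shows "(\<Sum>i\<le>M. (norm (\<Sum>j\<le>i. h j * b (i - j)))\<^sup>2) \<le> (\<Sum>j\<le>D. (norm (h j))\<^sup>2)"
proof -
  let ?c = "\<lambda>i. \<Sum>j\<le>i. h j * b (i - j)" and ?P = "\<lambda>z. \<Sum>j\<le>D. h j * z ^ j"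
  have A: "(\<Sum>j\<le>D. fps_const (h j) * fps_X ^ j) = Abs_fps h"
    using h by (auto simp: fps_eq_iff fps_sum_nth if_distrib sum.delta not_le cong: if_cong)
  have exp: "(\<lambda>z. ?P z * g z) has_fps_expansion Abs_fps h * Abs_fps b"
    by (intro has_fps_expansion_mult has_fps_expansion, subst A [symmetric])
       (intro fps_expansion_intros)
  have hol: "(\<lambda>z. ?P z * g z) holomorphic_on ball 0 1"
    by (intro holomorphic_intros holomorphic)
  have nth: "fps_nth (Abs_fps h * Abs_fps b) i = ?c i" for i
    by (simp add: fps_mult_nth atLeast0AtMost)
  have le: "r ^ (2 * k) * (\<Sum>i\<le>M. (norm (?c i))\<^sup>2 * r ^ (2 * i)) \<le> (\<Sum>j\<le>D. (norm (h j))\<^sup>2 * r ^ (2 * j))"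
    if r: "0 < r" "r < 1" for r :: real
  proof -
    let ?w = "circlepath 0 r"
    note B = bessel_circle[OF hol exp r, unfolded nth]
    have "r ^ (2 * k) * (\<Sum>i\<le>M. (norm (?c i))\<^sup>2 * r ^ (2 * i))
        \<le> r ^ (2 * k) * integral {0..1} (\<lambda>t. (norm (?P (?w t) * g (?w t)))\<^sup>2)"
      using r by (intro mult_left_mono B(1)) auto
    also have "\<dots> = integral {0..1} (\<lambda>t. r ^ (2 * k) * (norm (?P (?w t) * g (?w t)))\<^sup>2)"
      by simp
    also have "\<dots> \<le> integral {0..1} (\<lambda>t. (norm (?P (?w t)))\<^sup>2)"
    proof (rule integral_le)
      show "(\<lambda>t. r ^ (2 * k) * (norm (?P (?w t) * g (?w t)))\<^sup>2) integrable_on {0..1}"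
        using integrable_on_mult_right[OF B(2)] by simp
      show "(\<lambda>t. (norm (?P (?w t)))\<^sup>2) integrable_on {0..1}"
        using parseval_poly_circle[OF r] by (rule has_integral_integrable)
      fix t :: real
      have n: "norm (?w t) = r" using r by (intro norm_circlepath_0) simp
      then have "norm (?w t ^ k * g (?w t)) \<le> 1" using r by (intro bounded) simp
      then have "(r ^ k * norm (g (?w t)))\<^sup>2 \<le> 1"
        using r n by (intro power_le_one) (auto simp: norm_mult norm_power)
      then have "(r ^ k * norm (g (?w t)))\<^sup>2 * (norm (?P (?w t)))\<^sup>2 \<le> 1 * (norm (?P (?w t)))\<^sup>2"
        by (intro mult_right_mono) auto
      then show "r ^ (2 * k) * (norm (?P (?w t) * g (?w t)))\<^sup>2 \<le> (norm (?P (?w t)))\<^sup>2"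
        by (simp add: norm_mult power_mult_distrib power_mult [symmetric] mult_ac)
    qed
    also have "\<dots> = (\<Sum>j\<le>D. (norm (h j))\<^sup>2 * r ^ (2 * j))"
      using parseval_poly_circle[OF r] by (rule integral_unique)
    finally show ?thesis .
  qed
  \<comment> \<open>Both sides of \<open>le\<close> are polynomials in \<open>r\<close>, so the
    inequality survives the limit \<open>r = 1\<close>, where all weights become 1.\<close>
  have "((\<lambda>r::real. r ^ (2 * k) * (\<Sum>i\<le>M. (norm (?c i))\<^sup>2 * r ^ (2 * i))) \<longlongrightarrow>
      1 ^ (2 * k) * (\<Sum>i\<le>M. (norm (?c i))\<^sup>2 * 1 ^ (2 * i))) (at_left 1)"
    by (intro tendsto_intros)
  moreover have "((\<lambda>r::real. \<Sum>j\<le>D. (norm (h j))\<^sup>2 * r ^ (2 * j)) \<longlongrightarrow>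
      (\<Sum>j\<le>D. (norm (h j))\<^sup>2 * 1 ^ (2 * j))) (at_left 1)"
    by (intro tendsto_intros)
  moreover have "eventually (\<lambda>r::real. r \<in> {0<..<1}) (at_left 1)"
    by (rule eventually_at_left_real) simp
  then have "eventually (\<lambda>r. r ^ (2 * k) * (\<Sum>i\<le>M. (norm (?c i))\<^sup>2 * r ^ (2 * i))
      \<le> (\<Sum>j\<le>D. (norm (h j))\<^sup>2 * r ^ (2 * j))) (at_left 1)"
    by eventually_elim (use le in auto)
  ultimately show ?thesis
    using tendsto_le[OF trivial_limit_at_left_real] by fastforce
qed

end

section \<open>Carlson's coefficient inequalities\<close>

lemma ex_unit_factor:
  fixes z :: complex
  obtains \<omega> where "norm \<omega> = 1" "z = of_real (norm z) * \<omega>"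
proof (cases "z = 0")
  case True
  then show ?thesis using that[of 1] by simp
next
  case False
  then show ?thesis using that[of "z / of_real (norm z)"] by (simp add: norm_divide)
qed

text \<open>The hypothesis is what the contraction yields for a family of multipliers with a free
  scale \<open>t\<close>; the conclusion comes from the best choice of \<open>t\<close>.\<close>

lemma le_one_minus_of_quadratic:
  fixes \<alpha> X :: real
  assumes "\<alpha> \<ge> 0" "X \<ge> 0" and q: "\<And>t. t \<ge> 0 \<Longrightarrow> \<alpha> + (X + t * \<alpha>)\<^sup>2 \<le> 1 + t\<^sup>2 * \<alpha>"
  shows "X \<le> 1 - \<alpha>"
proof -
  have "\<alpha> \<le> 1" using q[of 0] zero_le_power2[of X] by (simp only: mult_zero_left add_0_right power2_eq_square) linarith
  show ?thesis
  proof (cases "\<alpha> = 1")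
    case True
    have "(X + 1)\<^sup>2 \<le> 1" using q[of 1] True by simp
    then show ?thesis using True \<open>X \<ge> 0\<close> by (simp add: power2_eq_square algebra_simps) (smt (verit) mult_nonneg_nonneg)
  next
    case False
    define \<beta> where "\<beta> = 1 - \<alpha>"
    have \<beta>: "\<beta> > 0" "\<alpha> = 1 - \<beta>" using False \<open>\<alpha> \<le> 1\<close> by (auto simp: \<beta>_def)
    \<comment> \<open>This \<open>t\<close> maximises
      \<open>(X + t * \<alpha>)\<^sup>2 - t\<^sup>2 * \<alpha>\<close>; there
      \<open>X + t * \<alpha>\<close> equals \<open>t\<close>, and the hypothesis collapses to
      \<open>t \<le> 1\<close>.\<close>
    define t where "t = X / \<beta>"
    have X: "X = t * \<beta>" and "t \<ge> 0" using \<beta> \<open>X \<ge> 0\<close> by (auto simp: t_def)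
    have "1 - \<beta> + (t * \<beta> + t * (1 - \<beta>))\<^sup>2 \<le> 1 + t\<^sup>2 * (1 - \<beta>)"
      using q[OF \<open>t \<ge> 0\<close>] unfolding X \<beta>(2) .
    moreover have "t * \<beta> + t * (1 - \<beta>) = t" by (simp add: algebra_simps)
    ultimately have "t\<^sup>2 * \<beta> \<le> 1 * \<beta>" by (simp add: algebra_simps)
    then have "t\<^sup>2 \<le> 1" using \<beta> by (simp only: mult_le_cancel_right_pos)
    then have "t \<le> 1" using abs_le_square_iff[of t 1] by simp
    then show ?thesis using \<beta> by (simp add: X)
  qed
qed

context bounded_series
begin

lemma sum_norm_coeff_squares_le: "(\<Sum>i\<le>n. (norm (b i))\<^sup>2) \<le> 1"
proof -
  \<comment> \<open>The multiplier is the constant polynomial 1.\<close>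
  have "(\<Sum>j\<le>i. of_bool (j = 0) * b (i - j)) = b i" for i
    by (subst sum.remove[of _ 0]) (auto intro!: sum.neutral)
  then show ?thesis
    using toeplitz_contraction[of 0 "\<lambda>j. of_bool (j = 0)" n] by simp
qed

text \<open>In both inequalities the multiplier \<open>h\<close> ends in a multiple of the reversed conjugated
  coefficients, which makes the \<open>N\<close>-th coefficient of the product as large as possible.\<close>

lemma carlson_odd: "norm (b (2 * n + 1)) \<le> 1 - (\<Sum>i\<le>n. (norm (b i))\<^sup>2)"
proof (rule le_one_minus_of_quadratic)
  let ?\<alpha> = "\<Sum>i\<le>n. (norm (b i))\<^sup>2" and ?N = "2 * n + 1"
  show "?\<alpha> \<ge> 0" by (intro sum_nonneg) simp
  fix t :: real assume t: "t \<ge> 0"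
  \<comment> \<open>The phase of \<open>b ?N\<close>, built into \<open>h\<close> so that the added
    terms reinforce \<open>b ?N\<close> without cancellation.\<close>
  obtain \<omega> where \<omega>: "norm \<omega> = 1" "b ?N = of_real (norm (b ?N)) * \<omega>"
    by (rule ex_unit_factor)
  define h where "h = (\<lambda>j. if j = 0 then 1 else if j \<in> {n+1..?N} then of_real t * \<omega> * cnj (b (?N - j)) else 0)"
  let ?c = "\<lambda>i. \<Sum>j\<le>i. h j * b (i - j)"
  have refl: "(\<Sum>j\<in>{n+1..?N}. u (?N - j)) = (\<Sum>i\<le>n. u i)" for u :: "nat \<Rightarrow> 'z::comm_monoid_add"
    by (rule sum.reindex_bij_witness[of _ "\<lambda>i. ?N - i" "\<lambda>i. ?N - i"]) auto
  \<comment> \<open>\<open>h\<close> vanishes at the indices 1 to \<open>n\<close>, so the first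
    \<open>n + 1\<close> coefficients of the product are those of \<open>g\<close>.\<close>
  have low: "?c i = b i" if "i \<le> n" for i
    using that by (subst sum.remove[of _ 0]) (auto simp: h_def intro!: sum.neutral)
  have "?c ?N = (\<Sum>j\<in>insert 0 {n+1..?N}. h j * b (?N - j))"
    by (rule sum.mono_neutral_right) (auto simp: h_def)
  also have "\<dots> = b ?N + (\<Sum>j\<in>{n+1..?N}. of_real t * \<omega> * of_real ((norm (b (?N - j)))\<^sup>2))"
    by (subst sum.insert) (auto simp: h_def complex_norm_square mult_ac simp del: of_real_power sum.cl_ivl_Suc intro!: sum.cong)
  also have "\<dots> = b ?N + of_real t * \<omega> * of_real ?\<alpha>"
    by (subst refl) (simp add: sum_distrib_left)
  also have "\<dots> = \<omega> * of_real (norm (b ?N) + t * ?\<alpha>)"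
    by (subst \<omega>(2)) (simp add: algebra_simps)
  finally have top: "norm (?c ?N) = norm (b ?N) + t * ?\<alpha>"
    using \<omega>(1) t \<open>?\<alpha> \<ge> 0\<close> by (simp only: norm_mult norm_of_real) simp
  have "(\<Sum>j\<le>?N. (norm (h j))\<^sup>2) = (\<Sum>j\<in>insert 0 {n+1..?N}. (norm (h j))\<^sup>2)"
    by (rule sum.mono_neutral_right) (auto simp: h_def)
  also have "\<dots> = 1 + (\<Sum>j\<in>{n+1..?N}. t\<^sup>2 * (norm (b (?N - j)))\<^sup>2)"
    by (subst sum.insert) (auto simp: h_def \<omega>(1) norm_mult power_mult_distrib intro!: sum.cong)
  also have "\<dots> = 1 + t\<^sup>2 * ?\<alpha>" by (subst refl) (simp add: sum_distrib_left)
  finally have rhs: "(\<Sum>j\<le>?N. (norm (h j))\<^sup>2) = 1 + t\<^sup>2 * ?\<alpha>" .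
  \<comment> \<open>Only the coefficients 0 to \<open>n\<close> and \<open>?N\<close> of the product
    are kept; the squares in between are dropped.\<close>
  have "?\<alpha> + (norm (b ?N) + t * ?\<alpha>)\<^sup>2 = (\<Sum>i\<in>insert ?N {..n}. (norm (?c i))\<^sup>2)"
    unfolding top [symmetric] by (subst sum.insert) (auto simp: low simp del: sum.atMost_Suc)
  also have "\<dots> \<le> (\<Sum>i\<le>?N. (norm (?c i))\<^sup>2)"
    by (intro sum_mono2) auto
  also have "\<dots> \<le> 1 + t\<^sup>2 * ?\<alpha>"
    unfolding rhs [symmetric] by (rule toeplitz_contraction) (auto simp: h_def)
  finally show "?\<alpha> + (norm (b ?N) + t * ?\<alpha>)\<^sup>2 \<le> 1 + t\<^sup>2 * ?\<alpha>" .
qed simp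

lemma carlson_even:
  assumes n: "n > 0"
  shows "norm (b (2 * n)) \<le> 1 - (\<Sum>i<n. (norm (b i))\<^sup>2) - (norm (b n))\<^sup>2 / (1 + norm (b 0))"
proof -
  let ?\<alpha> = "\<Sum>i<n. (norm (b i))\<^sup>2" and ?N = "2 * n" and ?a = "norm (b 0)"
  let ?X = "norm (b ?N) + (norm (b n))\<^sup>2 / (1 + ?a)"
  have a: "1 + ?a > 0" by (rule add_pos_nonneg) auto
  have "?\<alpha> \<ge> 0" by (intro sum_nonneg) simp
  have "?X \<ge> 0" using a by simp
  obtain \<omega> where \<omega>: "norm \<omega> = 1" "b ?N = of_real (norm (b ?N)) * \<omega>"
    by (rule ex_unit_factor)
  \<comment> \<open>The size of \<open>c\<close> is chosen so that \<open>norm (b n) - norm c * norm (b 0) = norm c\<close>; then the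
    middle coefficient of the product pays for the norm of the middle term.\<close>
  define c where "c = \<omega> * cnj (b n) / of_real (1 + ?a)"
  have norm_c: "norm c = norm (b n) / (1 + ?a)"
    using a \<omega>(1) by (simp only: c_def norm_divide norm_mult norm_of_real) simp
  have c_le: "norm c \<le> norm (b n + c * b 0)"
  proof -
    have "norm c = norm (b n) - norm (c * b 0)"
      using a by (simp add: norm_c norm_mult field_simps)
    also have "\<dots> \<le> norm (b n + c * b 0)" by (rule norm_diff_ineq)
    finally show ?thesis .
  qed
  have "?X \<le> 1 - ?\<alpha>"
  proof (rule le_one_minus_of_quadratic)
    fix t :: real assume t: "t \<ge> 0"
    \<comment> \<open>The reflection of \<open>j\<close> to \<open>?N - j\<close> fixes
      \<open>n\<close>. This middle entry is the constant \<open>c\<close>, while only the entries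
      above it scale with \<open>t\<close>, as the quadratic lemma requires.\<close>
    define h where "h = (\<lambda>j. if j = 0 then 1 else if j = n then c
        else if j \<in> {n+1..?N} then of_real t * \<omega> * cnj (b (?N - j)) else 0)"
    let ?c = "\<lambda>i. \<Sum>j\<le>i. h j * b (i - j)"
    have refl: "(\<Sum>j\<in>{n+1..?N}. u (?N - j)) = (\<Sum>i<n. u i)" for u :: "nat \<Rightarrow> 'z::comm_monoid_add"
      by (rule sum.reindex_bij_witness[of _ "\<lambda>i. ?N - i" "\<lambda>i. ?N - i"]) auto
    have low: "?c i = b i" if "i < n" for i
      using that by (subst sum.remove[of _ 0]) (auto simp: h_def intro!: sum.neutral)
    have "?c n = (\<Sum>j\<in>{0, n}. h j * b (n - j))"
      by (rule sum.mono_neutral_right) (auto simp: h_def)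
    then have mid: "?c n = b n + c * b 0" using n by (simp add: h_def)
    have "?c ?N = (\<Sum>j\<in>insert 0 (insert n {n+1..?N}). h j * b (?N - j))"
      by (rule sum.mono_neutral_right) (auto simp: h_def)
    also have "\<dots> = b ?N + (c * b n + (\<Sum>j\<in>{n+1..?N}. of_real t * \<omega> * of_real ((norm (b (?N - j)))\<^sup>2)))"
      using n by (subst sum.insert, simp, simp, subst sum.insert)
        (auto simp: h_def complex_norm_square mult_ac simp del: of_real_power sum.cl_ivl_Suc intro!: sum.cong)
    also have "\<dots> = b ?N + (c * b n + of_real t * \<omega> * of_real ?\<alpha>)"
      by (subst refl) (simp add: sum_distrib_left)
    also have "c * b n = \<omega> * of_real ((norm (b n))\<^sup>2 / (1 + ?a))"
      by (simp add: c_def complex_norm_square mult_ac del: of_real_power)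
    also have "b ?N + (\<omega> * of_real ((norm (b n))\<^sup>2 / (1 + ?a)) + of_real t * \<omega> * of_real ?\<alpha>) = \<omega> * of_real (?X + t * ?\<alpha>)"
      by (subst \<omega>(2)) (simp add: algebra_simps)
    finally have top: "norm (?c ?N) = ?X + t * ?\<alpha>"
      using \<omega>(1) t \<open>?\<alpha> \<ge> 0\<close> \<open>?X \<ge> 0\<close> by (simp only: norm_mult norm_of_real) simp
    have "(\<Sum>j\<le>?N. (norm (h j))\<^sup>2) = (\<Sum>j\<in>insert 0 (insert n {n+1..?N}). (norm (h j))\<^sup>2)"
      by (rule sum.mono_neutral_right) (auto simp: h_def)
    also have "\<dots> = 1 + ((norm c)\<^sup>2 + (\<Sum>j\<in>{n+1..?N}. t\<^sup>2 * (norm (b (?N - j)))\<^sup>2))"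
      using n by (subst sum.insert, simp, simp, subst sum.insert)
        (auto simp: h_def \<omega>(1) norm_mult power_mult_distrib intro!: sum.cong)
    also have "\<dots> = 1 + (norm c)\<^sup>2 + t\<^sup>2 * ?\<alpha>" by (subst refl) (simp add: sum_distrib_left)
    finally have rhs: "(\<Sum>j\<le>?N. (norm (h j))\<^sup>2) = 1 + (norm c)\<^sup>2 + t\<^sup>2 * ?\<alpha>" .
    \<comment> \<open>By \<open>c_le\<close> the coefficient at \<open>n\<close> contributes at
      least \<open>(norm c)\<^sup>2\<close>, which cancels the same amount in the norm of
      \<open>h\<close>.\<close>
    have "(norm c)\<^sup>2 + (?\<alpha> + (?X + t * ?\<alpha>)\<^sup>2) \<le> (norm (?c n))\<^sup>2 + (?\<alpha> + (?X + t * ?\<alpha>)\<^sup>2)"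
      unfolding mid by (intro add_right_mono power_mono c_le) auto
    also have "\<dots> = (\<Sum>i\<in>insert ?N (insert n {..<n}). (norm (?c i))\<^sup>2)"
      using n by (subst sum.insert, simp, simp, subst sum.insert) (auto simp: low top)
    also have "\<dots> \<le> (\<Sum>i\<le>?N. (norm (?c i))\<^sup>2)"
      by (intro sum_mono2) auto
    also have "\<dots> \<le> 1 + (norm c)\<^sup>2 + t\<^sup>2 * ?\<alpha>"
      unfolding rhs [symmetric] by (rule toeplitz_contraction) (auto simp: h_def)
    finally show "?\<alpha> + (?X + t * ?\<alpha>)\<^sup>2 \<le> 1 + t\<^sup>2 * ?\<alpha>" by simp
  qed fact+
  then show ?thesis by simp
qed

section \<open>The refined Bohr inequality for the coefficients of \<open>g\<close>\<close>

text \<open>The subtracted term is what makes the induction close: it is the geometric tail over the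
  exponents above \<open>2 * n\<close>, weighted by the common part of Carlson's bounds. Each step
  spends its first two terms on one odd and one even coefficient. The weights
  \<open>1 / (1 + a)\<close> and \<open>r / (1 - r)\<close> then balance exactly the loss in
  \<open>carlson_even\<close> and the shrinking of the remaining tail.\<close>

lemma refined_bohr_partial:
  fixes r :: real
  assumes r: "0 \<le> r" "r < 1"
  defines "a \<equiv> norm (b 0)"
  shows "(\<Sum>m\<le>2*n. norm (b m) * r ^ m) + (1 / (1 + a) + r / (1 - r)) * (\<Sum>j\<le>n. (norm (b j))\<^sup>2 * r ^ (2 * j))
    \<le> a + a\<^sup>2 / (1 + a) + r / (1 - r) - r ^ (2 * n + 1) / (1 - r) * (1 - (\<Sum>j\<le>n. (norm (b j))\<^sup>2))"
proof (induction n)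
  case 0
  have "r / (1 - r) * a\<^sup>2 = r / (1 - r) - r / (1 - r) * (1 - a\<^sup>2)" by (simp add: algebra_simps)
  then show ?case by (simp add: a_def distrib_right)
next
  case (Suc n)
  define \<sigma> where "\<sigma> = (\<Sum>j\<le>n. (norm (b j))\<^sup>2)"
  define q where "q = (norm (b (Suc n)))\<^sup>2"
  define s where "s = r ^ (2 * n + 1)"
  have s: "s \<ge> 0" using r by (simp add: s_def)
  have odd: "norm (b (2 * n + 1)) * s \<le> (1 - \<sigma>) * s"
    unfolding \<sigma>_def by (intro mult_right_mono carlson_odd s)
  have "norm (b (2 * Suc n)) \<le> 1 - \<sigma> - q / (1 + a)"
    using carlson_even[of "Suc n"] by (simp add: \<sigma>_def q_def a_def lessThan_Suc_atMost del: mult_Suc_right)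
  then have even: "norm (b (2 * Suc n)) * (s * r) \<le> (1 - \<sigma> - q / (1 + a)) * (s * r)"
    using s r by (intro mult_right_mono) auto
  \<comment> \<open>The tail \<open>s / (1 - r)\<close> loses its first two terms \<open>s\<close>
    and \<open>s * r\<close>; the rest is named \<open>u\<close> below.\<close>
  have id: "s / (1 - r) = s + s * r + s * r\<^sup>2 / (1 - r)" "s * r * (r / (1 - r)) = s * r\<^sup>2 / (1 - r)"
    using r by (simp_all add: field_simps power2_eq_square)
  define u where "u = s * r\<^sup>2 / (1 - r)"
  have pw: "r ^ (2 * Suc n) = s * r" "r ^ (2 * Suc n + 1) / (1 - r) = u" "r ^ (2 * n + 1) = s"
    by (simp_all add: s_def u_def power2_eq_square)
  have sums: "(\<Sum>m\<le>2 * Suc n. norm (b m) * r ^ m)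
      = (\<Sum>m\<le>2 * n. norm (b m) * r ^ m) + norm (b (2 * n + 1)) * s + norm (b (2 * Suc n)) * (s * r)"
    by (simp add: s_def)
  have sq: "(1 / (1 + a) + r / (1 - r)) * (\<Sum>j\<le>Suc n. (norm (b j))\<^sup>2 * r ^ (2 * j))
      = (1 / (1 + a) + r / (1 - r)) * (\<Sum>j\<le>n. (norm (b j))\<^sup>2 * r ^ (2 * j))
        + (q / (1 + a) * (s * r) + q * u)"
  proof -
    have "q / (1 + a) * (s * r) + q * u = (1 / (1 + a) + r / (1 - r)) * (q * (s * r))"
      unfolding u_def id(2) [symmetric] by (simp add: algebra_simps)
    moreover have "(\<Sum>j\<le>Suc n. (norm (b j))\<^sup>2 * r ^ (2 * j)) = (\<Sum>j\<le>n. (norm (b j))\<^sup>2 * r ^ (2 * j)) + q * (s * r)"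
      unfolding pw(1) [symmetric] q_def by (rule sum.atMost_Suc)
    ultimately show ?thesis by (simp only: distrib_left)
  qed
  have \<sigma>': "(\<Sum>j\<le>Suc n. (norm (b j))\<^sup>2) = \<sigma> + q" by (simp add: \<sigma>_def q_def)
  have IH: "(\<Sum>m\<le>2*n. norm (b m) * r ^ m) + (1 / (1 + a) + r / (1 - r)) * (\<Sum>j\<le>n. (norm (b j))\<^sup>2 * r ^ (2 * j))
    \<le> a + a\<^sup>2 / (1 + a) + r / (1 - r) - (s + s * r + u) * (1 - \<sigma>)"
    using Suc unfolding pw(3) \<sigma>_def [symmetric] id(1) u_def .
  define p where "p = q / (1 + a)"
  show ?case
    unfolding sums sq \<sigma>' pw(2) p_def [symmetric]
    using IH odd even[folded p_def] by (simp add: algebra_simps)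
qed

lemma norm_coeff_le_1: "norm (b n) \<le> 1"
proof -
  have "(norm (b n))\<^sup>2 \<le> (\<Sum>i\<le>n. (norm (b i))\<^sup>2)"
    by (rule member_le_sum) auto
  also have "\<dots> \<le> 1" by (rule sum_norm_coeff_squares_le)
  finally show ?thesis by (simp add: power2_le_iff_abs_le abs_square_le_1)
qed

lemma summable_norm_coeff_powers:
  fixes r :: real
  assumes r: "0 \<le> r" "r < 1"
  shows "summable (\<lambda>n. norm (b n) * r ^ n)" "summable (\<lambda>n. (norm (b n))\<^sup>2 * r ^ (2 * n))"
proof -
  show "summable (\<lambda>n. norm (b n) * r ^ n)"
    by (rule summable_comparison_test'[of "\<lambda>n. r ^ n" 0])
       (use r norm_coeff_le_1 in \<open>auto intro!: summable_geometric mult_left_le_one_le simp: norm_mult\<close>)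
  have "summable (\<lambda>n. (r\<^sup>2) ^ n)"
    using r by (intro summable_geometric) (simp add: power_less_one_iff)
  moreover have "norm ((norm (b n))\<^sup>2 * r ^ (2 * n)) \<le> (r\<^sup>2) ^ n" for n
  proof -
    have "(norm (b n))\<^sup>2 * (r\<^sup>2) ^ n \<le> (r\<^sup>2) ^ n"
      by (intro mult_left_le_one_le power_le_one norm_coeff_le_1) auto
    then show ?thesis using r by (simp add: power_mult)
  qed
  ultimately show "summable (\<lambda>n. (norm (b n))\<^sup>2 * r ^ (2 * n))"
    by (rule summable_comparison_test')
qed

lemma refined_bohr:
  fixes r :: real
  assumes r: "0 \<le> r" "r < 1"
  shows "(\<Sum>n. norm (b n) * r ^ n)
      + (1 / (1 + norm (b 0)) + r / (1 - r)) * (\<Sum>n. (norm (b n))\<^sup>2 * r ^ (2 * n))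
    \<le> 3 / 2 + r / (1 - r)"
proof (rule LIMSEQ_le_const2)
  let ?a = "norm (b 0)"
  let ?L = "\<lambda>n. (\<Sum>m\<le>2*n. norm (b m) * r ^ m)
    + (1 / (1 + ?a) + r / (1 - r)) * (\<Sum>j\<le>n. (norm (b j))\<^sup>2 * r ^ (2 * j))"
  \<comment> \<open>\<open>?L n\<close> pairs the partial sum up to \<open>2 * n\<close> with one up
    to \<open>n\<close>, so the first series converges along a subsequence.\<close>
  have "filterlim (\<lambda>n::nat. 2 * n) sequentially sequentially"
    by (intro filterlim_subseq strict_monoI) simp
  then show "?L \<longlonglongrightarrow> (\<Sum>n. norm (b n) * r ^ n)
      + (1 / (1 + ?a) + r / (1 - r)) * (\<Sum>n. (norm (b n))\<^sup>2 * r ^ (2 * n))"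
    by (intro tendsto_intros summable_LIMSEQ' summable_norm_coeff_powers r
        filterlim_compose[OF summable_LIMSEQ'[OF summable_norm_coeff_powers(1)[OF r]]])
  have "?L n \<le> 3 / 2 + r / (1 - r)" for n
  proof -
    have a: "0 \<le> ?a" "?a \<le> 1" by (auto intro: norm_coeff_le_1)
    have "?L n \<le> ?a + ?a\<^sup>2 / (1 + ?a) + r / (1 - r) - r ^ (2 * n + 1) / (1 - r) * (1 - (\<Sum>j\<le>n. (norm (b j))\<^sup>2))"
      by (rule refined_bohr_partial[OF r])
    moreover have "0 \<le> r ^ (2 * n + 1) / (1 - r) * (1 - (\<Sum>j\<le>n. (norm (b j))\<^sup>2))"
      using r sum_norm_coeff_squares_le by (intro mult_nonneg_nonneg) auto
    moreover have "?a\<^sup>2 / (1 + ?a) \<le> 1 / 2"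
    proof -
      have "?a * ?a \<le> 1 * ?a" using a by (intro mult_right_mono)
      then show ?thesis using a by (simp add: divide_le_eq power2_eq_square not_less)
    qed
    ultimately show ?thesis using a by linarith
  qed
  then show "\<exists>N. \<forall>n\<ge>N. ?L n \<le> 3 / 2 + r / (1 - r)" by blast
qed

end

section \<open>The equation defining \<open>bohr_S\<close>\<close>

text \<open>Both \<open>z ^ (k - 2)\<close> and \<open>z\<^sup>2 * (3 - z)\<close> are nondecreasing
  on the unit interval; strictness comes from the linear term \<open>2 * (1 - z)\<close>.\<close>

lemma bohr_poly_strict_antimono:
  fixes x y :: real
  assumes k: "k \<ge> 2" and xy: "0 \<le> x" "x < y" "y \<le> 1"
  shows "2 * (1 - y) - y ^ k * (3 - y) < 2 * (1 - x) - x ^ k * (3 - x)"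
proof -
  have split: "z ^ k * (3 - z) = z ^ (k - 2) * (z\<^sup>2 * (3 - z))" for z :: real
    using power_add[of z "k - 2" 2] by (simp only: le_add_diff_inverse2[OF k] mult.assoc)
  \<comment> \<open>The aim is nonnegativity of the difference quotient of
    \<open>z\<^sup>2 * (3 - z)\<close>, here rewritten with visibly nonnegative summands.\<close>
  have "0 \<le> x * (1 - x) + x * (1 - y) + y * (1 - y) + (x + 2 * y)"
    using xy by (intro add_nonneg_nonneg mult_nonneg_nonneg) auto
  also have "\<dots> = 3 * (x + y) - (x * x + x * y + y * y)"
    by (simp add: algebra_simps)
  finally have "0 \<le> (y - x) * (3 * (x + y) - (x * x + x * y + y * y))"
    using xy by (intro mult_nonneg_nonneg) simp_all
  then have "x\<^sup>2 * (3 - x) \<le> y\<^sup>2 * (3 - y)"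
    by (simp add: power2_eq_square algebra_simps)
  then have "x ^ k * (3 - x) \<le> y ^ k * (3 - y)"
    unfolding split using xy by - (rule mult_mono, auto intro: power_mono)
  with xy show ?thesis
    by (intro order.strict_trans2[OF diff_strict_right_mono diff_left_mono]) auto
qed

lemma ex1_bohr_root:
  assumes k: "k \<ge> 2"
  shows "\<exists>!r. is_bohr_root k r"
proof -
  let ?p = "\<lambda>r::real. 2 * (1 - r) - r ^ k * (3 - r)"
  \<comment> \<open>The polynomial takes the values 2 at 0 and -2 at 1.\<close>
  have "\<exists>r\<ge>0. r \<le> 1 \<and> ?p r = 0"
    using k by (intro IVT2') (auto simp: power_0_left intro!: continuous_intros)
  then obtain r where r: "0 \<le> r" "r \<le> 1" "?p r = 0" by blast
  moreover have "r \<noteq> 0" "r \<noteq> 1" using r(3) k by (auto simp: power_0_left)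
  ultimately have "is_bohr_root k r" by (auto simp: is_bohr_root_def)
  moreover have "x = y" if "is_bohr_root k x" "is_bohr_root k y" for x y
    using that bohr_poly_strict_antimono[OF k, of x y] bohr_poly_strict_antimono[OF k, of y x]
    by (cases x y rule: linorder_cases) (auto simp: is_bohr_root_def)
  ultimately show ?thesis by blast
qed

lemma is_bohr_root_bohr_S: "k \<ge> 2 \<Longrightarrow> is_bohr_root k (bohr_S k)"
  unfolding bohr_S_def by (rule theI'[OF ex1_bohr_root])

section \<open>From \<open>g\<close> back to \<open>f\<close>, and the bound up to
  \<open>bohr_S\<close>\<close>

text \<open>Defining \<open>g\<close> by the shifted series instead of as \<open>f z / z ^ k\<close>
  leaves no singularity at 0 to remove. Only its summability at 0 is treated apart, since
  \<open>z ^ k\<close> cannot be cancelled there when \<open>k > 0\<close>.\<close>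

lemma bounded_series_of_class_Bk:
  assumes f: "f \<in> class_Bk k" and a: "has_expansion k a f"
  shows "bounded_series k (\<lambda>n. a (n + k)) (\<lambda>z. \<Sum>n. a (n + k) * z ^ n)"
proof
  fix z :: complex assume z: "norm z < 1"
  have f_sums: "(\<lambda>n. z ^ k * (a (n + k) * z ^ n)) sums f z"
    using a z by (simp add: has_expansion_def power_add mult_ac)
  have "summable (\<lambda>n. a (n + k) * z ^ n)"
  proof (cases "z = 0")
    case True
    then show ?thesis by (simp add: summable_0_powser)
  next
    case False
    then show ?thesis using sums_summable[OF f_sums] by (simp add: summable_cmult_iff)
  qed
  then show s: "(\<lambda>n. a (n + k) * z ^ n) sums (\<Sum>n. a (n + k) * z ^ n)"
    by (rule summable_sums)
  have "z ^ k * (\<Sum>n. a (n + k) * z ^ n) = f z"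
    using sums_unique2[OF sums_mult[OF s] f_sums] .
  then show "norm (z ^ k * (\<Sum>n. a (n + k) * z ^ n)) \<le> 1"
    using f z by (simp add: class_Bk_def class_B_def)
qed

text \<open>The second series carries \<open>r ^ (2 * k)\<close>; the negative powers in its weight
  absorb one factor \<open>r ^ k\<close>, and the other is common to both series.\<close>

lemma bohr_lhs_eq:
  assumes r: "r > 0"
    and s: "summable (\<lambda>n. norm (a (n + k)) * r ^ n)" "summable (\<lambda>n. (norm (a (n + k)))\<^sup>2 * r ^ (2 * n))"
  shows "bohr_lhs k a r = r ^ k * ((\<Sum>n. norm (a (n + k)) * r ^ n)
      + (1 / (1 + norm (a k)) + r / (1 - r)) * (\<Sum>n. (norm (a (n + k)))\<^sup>2 * r ^ (2 * n)))"
proof -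
  have "(\<Sum>n. norm (a (n + k)) * r ^ (n + k)) = r ^ k * (\<Sum>n. norm (a (n + k)) * r ^ n)"
    by (subst suminf_mult[OF s(1), symmetric]) (simp add: power_add mult_ac)
  moreover have "(\<Sum>n. (norm (a (n + k)))\<^sup>2 * r ^ (2 * (n + k)))
      = (r ^ k * r ^ k) * (\<Sum>n. (norm (a (n + k)))\<^sup>2 * r ^ (2 * n))"
    by (subst suminf_mult[OF s(2), symmetric]) (simp add: distrib_left power_add power_mult power2_eq_square power_mult_distrib mult_ac)
  moreover have "r powi (- int k) * r ^ k = 1" "r powi (1 - int k) * r ^ k = r"
    using r by (simp_all add: power_int_minus power_int_diff)
  moreover have "(p / u + q / v) * (R * R * T) = R * ((p * R / u + q * R / v) * T)"
    for p q u v R T :: real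
    by (simp add: algebra_simps)
  ultimately show ?thesis by (simp only: bohr_lhs_def distrib_left)
qed

lemma bohr_lhs_le_1:
  assumes k: "k \<ge> 2" and f: "f \<in> class_Bk k" "has_expansion k a f" and r: "r \<in> {0..bohr_S k}"
  shows "bohr_lhs k a r \<le> 1"
proof (cases "r = 0")
  case True
  then show ?thesis using k by (simp add: bohr_lhs_0)
next
  case False
  have S: "0 < bohr_S k" "bohr_S k < 1" "2 * (1 - bohr_S k) - bohr_S k ^ k * (3 - bohr_S k) = 0"
    using is_bohr_root_bohr_S[OF k] by (auto simp: is_bohr_root_def)
  have r': "0 < r" "r < 1" using r False S by auto
  interpret bounded_series k "\<lambda>n. a (n + k)" "\<lambda>z. \<Sum>n. a (n + k) * z ^ n"
    by (rule bounded_series_of_class_Bk[OF f])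
  have "0 \<le> 2 * (1 - r) - r ^ k * (3 - r)"
    using bohr_poly_strict_antimono[OF k, of r "bohr_S k"] r r' S by (cases "r = bohr_S k") auto
  \<comment> \<open>Here \<open>3 / 2 + r / (1 - r)\<close> equals
    \<open>(3 - r) / (2 * (1 - r))\<close>, which is how the defining equation of
    \<open>bohr_S\<close> arises.\<close>
  then have poly: "r ^ k * (3 / 2 + r / (1 - r)) \<le> 1"
    using r' by (simp add: field_simps)
  have "bohr_lhs k a r \<le> r ^ k * (3 / 2 + r / (1 - r))"
    using r' refined_bohr[of r] summable_norm_coeff_powers[of r]
    by (subst bohr_lhs_eq) (auto intro!: mult_left_mono)
  with poly show ?thesis by linarith
qed

section \<open>Sharpness, witnessed by the \<open>k\<close>-th power function\<close>

lemma power_in_class_Bk: "(\<lambda>z. z ^ k) \<in> class_Bk k"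
proof -
  have "(deriv ^^ j) (\<lambda>z. z ^ k) (0 :: complex) = 0" if "j < k" for j
    using higher_deriv_power[of j "0 :: complex" k 0] that by simp
  then show ?thesis
    by (auto simp: class_Bk_def class_B_def norm_power power_le_one intro!: analytic_intros)
qed

lemma has_expansion_power: "has_expansion k (\<lambda>n. of_bool (n = k)) (\<lambda>z. z ^ k)"
  unfolding has_expansion_def
proof
  fix z :: complex
  show "(\<lambda>n. of_bool (n + k = k) * z ^ (n + k)) sums z ^ k"
    using sums_single[of 0 "\<lambda>n. z ^ (n + k)"] by (simp add: of_bool_def if_distribR if_distrib cong: if_cong)
qed

text \<open>After extracting \<open>r ^ k\<close> both series reduce to the single term 1, and the
  weight \<open>1 / (1 + norm (a k))\<close> is \<open>1 / 2\<close>.\<close>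

lemma bohr_lhs_power:
  assumes r: "0 < r"
  shows "bohr_lhs k (\<lambda>n. of_bool (n = k)) r = r ^ k * (3 / 2 + r / (1 - r))"
proof -
  have "(\<lambda>n. norm (of_bool (n + k = k) :: complex) * r ^ n) sums 1"
    using sums_single[of 0 "\<lambda>n. r ^ n"] by (simp add: of_bool_def if_distribR if_distrib cong: if_cong)
  moreover have "(\<lambda>n. (norm (of_bool (n + k = k) :: complex))\<^sup>2 * r ^ (2 * n)) sums 1"
    using sums_single[of 0 "\<lambda>n. r ^ (2 * n)"] by (simp add: of_bool_def if_distribR if_distrib cong: if_cong)
  ultimately show ?thesis
    using r by (subst bohr_lhs_eq) (auto simp: sums_iff)
qed

theorem theorem2:
  fixes k :: nat
  assumes "k \<ge> 2"
  shows "(\<exists>!r. is_bohr_root k r)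
    \<and> (\<forall>f\<in>class_Bk k. \<forall>a. has_expansion k a f \<longrightarrow>
         (\<forall>r\<in>{0..bohr_S k}. bohr_lhs k a r \<le> 1))
    \<and> (\<forall>S\<in>{bohr_S k<..<1}. \<exists>f\<in>class_Bk k. \<exists>a. has_expansion k a f \<and>
         (\<exists>r\<in>{0..S}. \<not> bohr_lhs k a r \<le> 1))"
proof (intro conjI ballI allI impI)
  show "\<exists>!r. is_bohr_root k r" by (rule ex1_bohr_root[OF assms])
next
  fix f a r
  assume "f \<in> class_Bk k" "has_expansion k a f" "r \<in> {0..bohr_S k}"
  then show "bohr_lhs k a r \<le> 1" by (rule bohr_lhs_le_1[OF assms])
next
  fix S assume S: "S \<in> {bohr_S k<..<1}"
  have root: "0 < bohr_S k" "2 * (1 - bohr_S k) - bohr_S k ^ k * (3 - bohr_S k) = 0"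
    using is_bohr_root_bohr_S[OF assms] by (auto simp: is_bohr_root_def)
  then have "2 * (1 - S) - S ^ k * (3 - S) < 0"
    using bohr_poly_strict_antimono[OF assms, of "bohr_S k" S] S by auto
  then have "1 < S ^ k * (3 / 2 + S / (1 - S))"
    using S by (simp add: field_simps)
  \<comment> \<open>The inequality already fails at the endpoint \<open>r = S\<close>.\<close>
  then have "\<not> bohr_lhs k (\<lambda>n. of_bool (n = k)) S \<le> 1"
    using S root by (simp add: bohr_lhs_power)
  then show "\<exists>f\<in>class_Bk k. \<exists>a. has_expansion k a f \<and> (\<exists>r\<in>{0..S}. \<not> bohr_lhs k a r \<le> 1)"
    using S root power_in_class_Bk[of k] has_expansion_power[of k]
    by (intro bexI exI conjI[OF has_expansion_power] bexI[of _ S]) auto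
qed

end
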